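(* Let $f:\mathbb{R}^p\to\mathbb{R}\cup\{\infty\}$ and $g:\mathbb{R}^q\to\mathbb{R}\cup\{\infty\}$ be closed, proper, convex functions, $A\in\mathbb{R}^{n\times p}$, $B\in\mathbb{R}^{n\times q}$, $c\in\mathbb{R}^n$, $\gamma>0$, and assume \[ (\mathrm{range}\,A^T)\cap\mathrm{ri}\,\mathrm{dom}(f^* )\neq\emptyset,\qquad (\mathrm{range}\,B^T)\cap\mathrm{ri}\,\mathrm{dom}(g^* )\neq\emptyset . \] Let $(x^k,y^k,\nu^k)$, $k\ge1$, be any sequence generated by ADMM. Suppose $d^\star=p^\star=\infty$ and the primal problem (P-ADMM) is infeasible. Then \[ \|Ax^k+By^k-c\|\to\inf_{x\in\mathrm{dom} f,\ y\in\mathrm{dom} g}\|Ax+By-c\| . \]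
   Context: A convex function is closed if its epigraph is closed, and proper if it is finite somewhere. $\mathrm{dom}$ is the effective domain (where the function is $<\infty$), $\mathrm{ri}$ the relative interior, and $f^*(\nu)=\sup_x\{\langle\nu,x\rangle-f(x)\}$ the convex conjugate. (P-ADMM): minimize $f(x)+g(y)$ over $x\in\mathbb{R}^p,y\in\mathbb{R}^q$ subject to $Ax+By=c$; its optimal value is $p^\star\in[-\infty,\infty]$. It is infeasible if no $x\in\mathrm{dom} f$, $y\in\mathrm{dom} g$ satisfy $Ax+By=c$ (then $p^\star=\infty$). (D-ADMM): maximize $-f^*(-A^T\nu)-g^*(-B^T\nu)-c^T\nu$ over $\nu\in\mathbb{R}^n$; its optimal value is $d^\star\in[-\infty,\infty]$ ($d^\star=-\infty$ if infeasible). ADMM, with arbitrary starting $y^0\in\mathbb{R}^q$, $\nu^0\in\mathbb{R}^n$, is, for $k=0,1,\dots$: $x^{k+1}\in\arg\min_{x}\{f(x)+\langle\nu^k,Ax+By^k-c\rangle+\frac{1}{2\gamma}\|Ax+By^k-c\|^2\}$, $y^{k+1}\in\arg\min_{y}\{g(y)+\langle\nu^k,Ax^{k+1}+By-c\rangle+\frac{1}{2\gamma}\|Ax^{k+1}+By-c\|^2\}$, $\nu^{k+1}=\nu^k+\frac1\gamma(Ax^{k+1}+By^{k+1}-c)$. (The relative-interior conditions ensure that the argmins are nonempty; any selection of minimizers is allowed.) *)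

theory Defs
  imports "HOL-Analysis.Analysis"
begin

(* Functions into the reals extended by infinity are modelled as ereal-valued functions.
   That a given function avoids -\<infinity> is a separate hypothesis where it is needed. *)

definition eff_dom :: "('a \<Rightarrow> ereal) \<Rightarrow> 'a set" where
  "eff_dom f = {x. f x < \<infinity>}"

(* The library's epigraph is restricted to real-valued functions. *)
definition ext_epigraph :: "('a \<Rightarrow> ereal) \<Rightarrow> ('a \<times> real) set" where
  "ext_epigraph f = {(x, t). f x \<le> ereal t}"

definition closed_fun :: "('a::topological_space \<Rightarrow> ereal) \<Rightarrow> bool" where
  "closed_fun f \<longleftrightarrow> closed (ext_epigraph f)"

definition proper_fun :: "('a \<Rightarrow> ereal) \<Rightarrow> bool" where
  "proper_fun f \<longleftrightarrow> (\<exists>x. \<bar>f x\<bar> \<noteq> \<infinity>)"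

(* Intended for functions that do not take the value -\<infinity>, so that the right-hand side
   never has the form \<infinity> - \<infinity>. *)
definition convex_fun :: "('a::real_vector \<Rightarrow> ereal) \<Rightarrow> bool" where
  "convex_fun f \<longleftrightarrow>
     (\<forall>x y. \<forall>t::real. 0 < t \<and> t < 1 \<longrightarrow>
        f (t *\<^sub>R x + (1 - t) *\<^sub>R y) \<le> ereal t * f x + ereal (1 - t) * f y)"

definition convex_conjugate :: "('a::real_inner \<Rightarrow> ereal) \<Rightarrow> 'a \<Rightarrow> ereal" where
  "convex_conjugate f \<nu> = (SUP x. ereal (\<nu> \<bullet> x) - f x)"

definition primal_feasible ::
  "(real^'p \<Rightarrow> ereal) \<Rightarrow> (real^'q \<Rightarrow> ereal) \<Rightarrow> real^'p^'n \<Rightarrow> real^'q^'n \<Rightarrow> real^'n \<Rightarrow> bool" where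
  "primal_feasible f g A B c \<longleftrightarrow>
     (\<exists>x\<in>eff_dom f. \<exists>y\<in>eff_dom g. A *v x + B *v y = c)"

definition primal_value ::
  "(real^'p \<Rightarrow> ereal) \<Rightarrow> (real^'q \<Rightarrow> ereal) \<Rightarrow> real^'p^'n \<Rightarrow> real^'q^'n \<Rightarrow> real^'n \<Rightarrow> ereal" where
  "primal_value f g A B c = (INF (x, y) \<in> {(x, y). A *v x + B *v y = c}. f x + g y)"

(* For f and g finite somewhere the conjugates never take the value -\<infinity>, so the objective
   never has the form \<infinity> - \<infinity>. *)
definition dual_value ::
  "(real^'p \<Rightarrow> ereal) \<Rightarrow> (real^'q \<Rightarrow> ereal) \<Rightarrow> real^'p^'n \<Rightarrow> real^'q^'n \<Rightarrow> real^'n \<Rightarrow> ereal" where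
  "dual_value f g A B c =
     (SUP \<nu>. - convex_conjugate f (- (transpose A *v \<nu>))
             - convex_conjugate g (- (transpose B *v \<nu>)) - ereal (c \<bullet> \<nu>))"

(* The starting values y 0 and \<nu> 0 are arbitrary; x 0 is never used. *)
definition admm_sequence ::
  "(real^'p \<Rightarrow> ereal) \<Rightarrow> (real^'q \<Rightarrow> ereal) \<Rightarrow> real^'p^'n \<Rightarrow> real^'q^'n \<Rightarrow> real^'n \<Rightarrow> real \<Rightarrow>
   (nat \<Rightarrow> real^'p) \<Rightarrow> (nat \<Rightarrow> real^'q) \<Rightarrow> (nat \<Rightarrow> real^'n) \<Rightarrow> bool" where
  "admm_sequence f g A B c \<gamma> x y \<nu> \<longleftrightarrow>
     (\<forall>k.
        is_arg_min
          (\<lambda>u. f u + ereal (\<nu> k \<bullet> (A *v u + B *v y k - c)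
                          + 1 / (2 * \<gamma>) * (norm (A *v u + B *v y k - c))\<^sup>2))
          (\<lambda>u. True) (x (Suc k)) \<and>
        is_arg_min
          (\<lambda>w. g w + ereal (\<nu> k \<bullet> (A *v x (Suc k) + B *v w - c)
                          + 1 / (2 * \<gamma>) * (norm (A *v x (Suc k) + B *v w - c))\<^sup>2))
          (\<lambda>w. True) (y (Suc k)) \<and>
        \<nu> (Suc k) = \<nu> k + (1 / \<gamma>) *\<^sub>R (A *v x (Suc k) + B *v y (Suc k) - c))"

end

theory Submission
  imports Defs
begin

text \<open>
  Write \<open>\<alpha> = 1/\<gamma>\<close>. In the dual variable, ADMM is Douglas--Rachford splitting: the points
  \<open>z k = \<nu> k - \<alpha> B y k\<close> form an orbit of a firmly nonexpansive map. The multiplier update and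
  monotonicity of the subdifferential of \<open>g\<close> give, for \<open>k \<ge> 1\<close>,
  \<open>\<alpha> * norm (A x (k+1) + B y (k+1) - c) = norm (\<nu> (k+1) - \<nu> k) \<le> norm (z (k+1) - z k)\<close>,
  so the residual, which is never below the infimum of all residuals, is controlled from above
  by the step length of the orbit.

  Step lengths of such an orbit decrease to some \<open>L\<close>, and the difference of consecutive steps,
  as vectors, tends to 0; hence the orbit really travels with speed \<open>L\<close>:
  \<open>m L \<le> norm (z m - z 0)\<close> (\<open>firm_orbit_escape_rate\<close>).

  It remains to show that the orbit cannot travel faster than \<open>\<alpha> * norm r\<close>, for any residual
  \<open>r = A u + B w - c\<close> of points of the two domains. A value \<open>\<infinity>\<close> of the dual yields a dual feasible
  \<open>\<nu>'\<close>. Combining the subgradient inequalities of the iterates at \<open>u\<close>, \<open>w\<close> with Fenchel's inequality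
  at \<open>\<nu>'\<close> bounds \<open>(z (k+1) - \<zeta>) \<bullet> (z (k+1) - z k)\<close>, for \<open>\<zeta> = \<nu>' - \<alpha> B w\<close>, by a constant plus
  \<open>\<alpha> * norm r * norm (z (k+1) - \<zeta>)\<close>. So far away from \<open>\<zeta>\<close> the distance to \<open>\<zeta>\<close> grows by at most
  about \<open>\<alpha> * norm r\<close> in each step (\<open>escape_rate_le\<close>). Taking the infimum over \<open>r\<close> squeezes the
  residuals of the iterates.
\<close>

section \<open>Orbits of firmly nonexpansive maps\<close>

lemma firm_difference_bound:
  fixes d e :: "'a::real_inner"
  assumes "e \<bullet> (e - d) \<le> 0"
  shows "(norm (e - d))\<^sup>2 \<le> (norm d)\<^sup>2 - (norm e)\<^sup>2"
  using assms by (simp add: power2_norm_eq_inner algebra_simps inner_commute)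

text \<open>
  The displacement over \<open>m\<close> steps is largest at the start of the orbit, and for late starting
  times it is close to \<open>m\<close> copies of a single step, because the squares of the second differences
  are dominated by the decrease of the squared step lengths.
\<close>
lemma firm_orbit_escape_rate:
  fixes z :: "nat \<Rightarrow> 'a::real_inner"
  assumes firm: "\<And>j k. (z (Suc j) - z (Suc k)) \<bullet> ((z (Suc j) - z (Suc k)) - (z j - z k)) \<le> 0"
  obtains L where "(\<lambda>k. norm (z (Suc k) - z k)) \<longlonglongrightarrow> L"
    and "\<And>m. real m * L \<le> norm (z m - z 0)"
proof -
  define \<Delta> where "\<Delta> k = z (Suc k) - z k" for k
  have nonexp: "norm (z (Suc j) - z (Suc k)) \<le> norm (z j - z k)" for j k
  proof -
    have "(norm (z (Suc j) - z (Suc k)))\<^sup>2 \<le> (norm (z j - z k))\<^sup>2"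
      using firm_difference_bound[OF firm, of j k]
        zero_le_power2[of "norm (z (Suc j) - z (Suc k) - (z j - z k))"] by linarith
    then show ?thesis by (rule power2_le_imp_le) simp
  qed
  have shift: "norm (z (n + m) - z n) \<le> norm (z m - z 0)" for n m
  proof (induction n)
    case (Suc n)
    have "norm (z (Suc n + m) - z (Suc n)) \<le> norm (z (n + m) - z n)"
      using nonexp[of "n + m" n] by simp
    with Suc show ?case by linarith
  qed simp
  have "decseq (\<lambda>k. norm (\<Delta> k))"
    unfolding decseq_Suc_iff \<Delta>_def using nonexp by blast
  then obtain L where L: "(\<lambda>k. norm (\<Delta> k)) \<longlonglongrightarrow> L"
    using decseq_convergent[of "\<lambda>k. norm (\<Delta> k)" 0] by auto
  have second: "(\<lambda>n. \<Delta> (Suc n) - \<Delta> n) \<longlonglongrightarrow> 0"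
  proof -
    have "(\<lambda>n. (norm (\<Delta> n))\<^sup>2 - (norm (\<Delta> (Suc n)))\<^sup>2) \<longlonglongrightarrow> L\<^sup>2 - L\<^sup>2"
      by (intro tendsto_diff tendsto_power L LIMSEQ_Suc)
    then have gap: "(\<lambda>n. (norm (\<Delta> n))\<^sup>2 - (norm (\<Delta> (Suc n)))\<^sup>2) \<longlonglongrightarrow> 0" by simp
    have le: "(norm (\<Delta> (Suc n) - \<Delta> n))\<^sup>2 \<le> (norm (\<Delta> n))\<^sup>2 - (norm (\<Delta> (Suc n)))\<^sup>2" for n
      unfolding \<Delta>_def by (rule firm_difference_bound) (rule firm)
    have "(\<lambda>n. (norm (\<Delta> (Suc n) - \<Delta> n))\<^sup>2) \<longlonglongrightarrow> 0"
      by (rule tendsto_sandwich[OF _ _ tendsto_const gap]) (simp_all add: le)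
    then have "(\<lambda>n. norm (\<Delta> (Suc n) - \<Delta> n)) \<longlonglongrightarrow> 0" by (simp add: power_tendsto_0_iff)
    then show ?thesis by (rule tendsto_norm_zero_cancel)
  qed
  have later: "(\<lambda>n. \<Delta> (n + j) - \<Delta> n) \<longlonglongrightarrow> 0" for j
  proof (induction j)
    case (Suc j)
    have "(\<lambda>n. (\<Delta> (Suc (n + j)) - \<Delta> (n + j)) + (\<Delta> (n + j) - \<Delta> n)) \<longlonglongrightarrow> 0 + 0"
      using LIMSEQ_ignore_initial_segment[OF second, of j] Suc by (intro tendsto_add) auto
    then show ?case by simp
  qed simp
  have steps: "(\<lambda>n. z (n + m) - z n - real m *\<^sub>R \<Delta> n) \<longlonglongrightarrow> 0" for m
  proof (induction m)
    case (Suc m)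
    have "(\<lambda>n. (z (n + m) - z n - real m *\<^sub>R \<Delta> n) + (\<Delta> (n + m) - \<Delta> n)) \<longlonglongrightarrow> 0 + 0"
      using Suc later by (rule tendsto_add)
    then show ?case by (simp add: \<Delta>_def algebra_simps)
  qed simp
  have "real m * L \<le> norm (z m - z 0)" for m
  proof -
    have "(\<lambda>n. real m * norm (\<Delta> n) - norm (z (n + m) - z n - real m *\<^sub>R \<Delta> n)) \<longlonglongrightarrow> real m * L - 0"
      by (intro tendsto_diff tendsto_mult tendsto_const L tendsto_norm_zero steps)
    moreover have "real m * norm (\<Delta> n) - norm (z (n + m) - z n - real m *\<^sub>R \<Delta> n) \<le> norm (z m - z 0)" for n
    proof -
      have "norm (real m *\<^sub>R \<Delta> n) \<le> norm (z (n + m) - z n) + norm (z (n + m) - z n - real m *\<^sub>R \<Delta> n)"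
        using norm_triangle_ineq4[of "z (n + m) - z n" "z (n + m) - z n - real m *\<^sub>R \<Delta> n"] by simp
      then show ?thesis using shift[of n m] by simp
    qed
    ultimately show ?thesis by (intro LIMSEQ_le_const2[of _ "real m * L"]) auto
  qed
  with L show thesis by (intro that) (auto simp: \<Delta>_def)
qed

text \<open>
  As long as \<open>a\<close> exceeds \<open>C / \<epsilon>\<close>, dividing by it turns the constant into an error below \<open>\<epsilon>\<close>;
  otherwise the bound is trivial.
\<close>
lemma linear_growth_bound:
  fixes a :: "nat \<Rightarrow> real"
  assumes "\<And>k. a k \<ge> 0" and "\<And>k. a (Suc k) * (a (Suc k) - a k) \<le> C + \<rho> * a (Suc k)"
    and "C \<ge> 0" and "\<rho> \<ge> 0" and "\<epsilon> > 0"
  shows "a k \<le> a 0 + C / \<epsilon> + real k * (\<rho> + \<epsilon>)"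
proof (induction k)
  case (Suc k)
  show ?case
  proof (cases "a (Suc k) \<le> C / \<epsilon>")
    case True
    have "0 \<le> real (Suc k) * (\<rho> + \<epsilon>)" using assms by simp
    then show ?thesis using True assms(1)[of 0] by linarith
  next
    case False
    then have "C \<le> \<epsilon> * a (Suc k)" using \<open>\<epsilon> > 0\<close> by (simp add: field_simps)
    moreover have pos: "a (Suc k) > 0"
      using False assms(3,5) divide_nonneg_pos[of C \<epsilon>] by linarith
    ultimately have "a (Suc k) * (a (Suc k) - a k) \<le> a (Suc k) * (\<rho> + \<epsilon>)"
      using assms(2)[of k] by (simp add: algebra_simps)
    then have "a (Suc k) - a k \<le> \<rho> + \<epsilon>" using pos by simp
    then show ?thesis using Suc by (simp add: algebra_simps)
  qed
qed (use assms in simp)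

text \<open>
  By Cauchy--Schwarz the drift condition limits the growth of the distance to \<open>\<zeta>\<close> to slightly
  more than \<open>\<rho>\<close> per step, which contradicts a larger speed of escape.
\<close>
lemma escape_rate_le:
  fixes z :: "nat \<Rightarrow> 'a::real_inner"
  assumes escape: "\<And>m. real m * L \<le> norm (z m - z 0)"
    and drift: "\<And>k. (z (Suc k) - \<zeta>) \<bullet> (z (Suc k) - z k) \<le> C + \<rho> * norm (z (Suc k) - \<zeta>)"
    and "C \<ge> 0" "\<rho> \<ge> 0"
  shows "L \<le> \<rho>"
proof (rule field_le_epsilon)
  fix \<epsilon> :: real assume "\<epsilon> > 0"
  define a where "a k = norm (z k - \<zeta>)" for k
  have growth: "a k \<le> a 0 + C / \<epsilon> + real k * (\<rho> + \<epsilon>)" for k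
  proof (rule linear_growth_bound)
    fix k
    have "a (Suc k) * a (Suc k) - (z (Suc k) - \<zeta>) \<bullet> (z k - \<zeta>)
        = (z (Suc k) - \<zeta>) \<bullet> (z (Suc k) - z k)"
      unfolding a_def by (simp add: power2_eq_square[symmetric] power2_norm_eq_inner inner_diff_right)
    moreover have "(z (Suc k) - \<zeta>) \<bullet> (z k - \<zeta>) \<le> a (Suc k) * a k"
      unfolding a_def by (rule norm_cauchy_schwarz)
    ultimately show "a (Suc k) * (a (Suc k) - a k) \<le> C + \<rho> * a (Suc k)"
      using drift[of k] by (simp add: a_def algebra_simps)
  qed (use assms \<open>\<epsilon> > 0\<close> in \<open>auto simp: a_def\<close>)
  have bound: "real m * (L - (\<rho> + \<epsilon>)) \<le> 2 * a 0 + C / \<epsilon>" for m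
  proof -
    have "norm (z m - z 0) \<le> a m + a 0"
      unfolding a_def using norm_triangle_ineq4[of "z m - \<zeta>" "z 0 - \<zeta>"] by simp
    then show ?thesis using escape[of m] growth[of m] by (simp add: algebra_simps)
  qed
  show "L \<le> \<rho> + \<epsilon>"
  proof (rule ccontr)
    assume "\<not> L \<le> \<rho> + \<epsilon>"
    then have "0 < L - (\<rho> + \<epsilon>)" by simp
    then obtain m where "2 * a 0 + C / \<epsilon> < real m * (L - (\<rho> + \<epsilon>))"
      using reals_Archimedean3 by blast
    with bound[of m] show False by simp
  qed
qed

section \<open>Subgradients\<close>

text \<open>
  The inequality is demanded at finite values of \<open>h\<close> only, so that it can be stated over the reals;
  for functions avoiding \<open>-\<infinity>\<close> this is the usual notion at points with a finite value.
\<close>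
definition subgradient_at :: "('a::real_inner \<Rightarrow> ereal) \<Rightarrow> 'a \<Rightarrow> 'a \<Rightarrow> bool" where
  "subgradient_at h \<mu> x \<longleftrightarrow>
     (\<exists>a. h x = ereal a \<and> (\<forall>u b. h u = ereal b \<longrightarrow> a + \<mu> \<bullet> (u - x) \<le> b))"

lemma subgradient_at_monotone:
  assumes "subgradient_at h \<mu> x" "subgradient_at h \<mu>' x'"
  shows "0 \<le> (\<mu> - \<mu>') \<bullet> (x - x')"
proof -
  obtain a a' where "a + \<mu> \<bullet> (x' - x) \<le> a'" "a' + \<mu>' \<bullet> (x - x') \<le> a"
    using assms unfolding subgradient_at_def by metis
  then show ?thesis by (simp add: algebra_simps)
qed

text \<open>
  Fenchel's inequality at \<open>x\<close> makes \<open>\<mu>0\<close> replace a subgradient at \<open>u\<close>. The price is a constant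
  depending on \<open>\<mu>0\<close> and \<open>u\<close> but not on \<open>x\<close> and \<open>\<mu>\<close>, hence uniform along a sequence of iterates.
\<close>
lemma subgradient_at_conjugate_bound:
  assumes "subgradient_at h \<mu> x" and s: "convex_conjugate h \<mu>0 = ereal s" and "h u = ereal b"
  shows "(\<mu> - \<mu>0) \<bullet> (u - x) \<le> b + s - \<mu>0 \<bullet> u"
proof -
  obtain a where a: "h x = ereal a" "a + \<mu> \<bullet> (u - x) \<le> b"
    using assms unfolding subgradient_at_def by metis
  have "ereal (\<mu>0 \<bullet> x) - h x \<le> convex_conjugate h \<mu>0"
    unfolding convex_conjugate_def by (rule SUP_upper) simp
  then have "\<mu>0 \<bullet> x - a \<le> s" using a s by simp
  with a show ?thesis by (simp add: algebra_simps)
qed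

lemma proper_fun_finite_point:
  fixes h :: "'a \<Rightarrow> ereal"
  assumes "proper_fun h"
  obtains u b where "h u = ereal b"
proof -
  have "\<exists>u. \<bar>h u\<bar> \<noteq> \<infinity>" using assms by (simp add: proper_fun_def)
  then obtain u where "\<bar>h u\<bar> \<noteq> \<infinity>" by (rule exE)
  then show thesis by (cases "h u") (auto intro: that)
qed

lemma convex_conjugate_not_MInfty:
  assumes "proper_fun h"
  shows "convex_conjugate h \<mu> \<noteq> -\<infinity>"
proof -
  obtain u b where u: "h u = ereal b" using assms by (rule proper_fun_finite_point)
  have "ereal (\<mu> \<bullet> u) - h u \<le> convex_conjugate h \<mu>"
    unfolding convex_conjugate_def by (rule SUP_upper) simp
  then show ?thesis using u by auto
qed

text \<open>
  Compare \<open>x\<close> with the points \<open>t u + (1 - t) x\<close>: convexity handles \<open>h\<close>, the penalty is quadratic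
  in \<open>t\<close>, and letting \<open>t\<close> tend to 0 leaves its linear term only.
\<close>
lemma argmin_optimality:
  fixes h :: "'a::real_vector \<Rightarrow> ereal" and R :: "'a \<Rightarrow> 'b::real_inner"
  assumes ninf: "\<And>u. h u \<noteq> -\<infinity>" and "proper_fun h" and "convex_fun h" and "\<gamma> > 0"
    and affine: "\<And>u t. R (t *\<^sub>R u + (1 - t) *\<^sub>R x) = R x + t *\<^sub>R (R u - R x)"
    and min: "is_arg_min (\<lambda>u. h u + ereal (\<nu> \<bullet> R u + 1 / (2 * \<gamma>) * (norm (R u))\<^sup>2)) (\<lambda>u. True) x"
  obtains a where "h x = ereal a"
    and "\<And>u b. h u = ereal b \<Longrightarrow> a \<le> b + (\<nu> + (1 / \<gamma>) *\<^sub>R R x) \<bullet> (R u - R x)"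
proof -
  define q where "q u = \<nu> \<bullet> R u + 1 / (2 * \<gamma>) * (norm (R u))\<^sup>2" for u
  have le: "h x + ereal (q x) \<le> h u + ereal (q u)" for u
    using min unfolding is_arg_min_def q_def by (simp add: not_less)
  obtain u0 b0 where "h u0 = ereal b0"
    using \<open>proper_fun h\<close> by (rule proper_fun_finite_point)
  then have "h x \<noteq> \<infinity>" using le[of u0] by auto
  then obtain a where a: "h x = ereal a" using ninf[of x] by (cases "h x") auto
  have "a \<le> b + (\<nu> + (1 / \<gamma>) *\<^sub>R R x) \<bullet> (R u - R x)" if b: "h u = ereal b" for u b
  proof -
    define d s M where "d = R u - R x" and "s = (\<nu> + (1 / \<gamma>) *\<^sub>R R x) \<bullet> d"
      and "M = 1 / (2 * \<gamma>) * (norm d)\<^sup>2"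
    have key: "a - b - s \<le> t * M" if t: "0 < t" "t < 1" for t
    proof -
      let ?w = "t *\<^sub>R u + (1 - t) *\<^sub>R x"
      have hw: "h ?w \<le> ereal (t * b + (1 - t) * a)"
        using \<open>convex_fun h\<close> t a b unfolding convex_fun_def by (metis plus_ereal.simps(1) times_ereal.simps(1))
      have qw: "q ?w = q x + t * s + t\<^sup>2 * M"
        unfolding q_def affine d_def[symmetric] s_def M_def power2_norm_eq_inner using \<open>\<gamma> > 0\<close>
        by (simp add: inner_add_left inner_add_right inner_commute field_simps power2_eq_square)
      have "ereal (a + q x) \<le> ereal (t * b + (1 - t) * a) + ereal (q ?w)"
        using le[of ?w] add_right_mono[OF hw, of "ereal (q ?w)"] unfolding a plus_ereal.simps
        by (rule order_trans)
      then have "a + q x \<le> t * b + (1 - t) * a + q x + t * s + t\<^sup>2 * M" by (simp add: qw)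
      then have "t * (a - b - s) \<le> t * (t * M)" by (simp add: algebra_simps power2_eq_square)
      then show ?thesis using t by simp
    qed
    have "((\<lambda>t. t * M) \<longlongrightarrow> 0 * M) (at_right 0)" by (intro tendsto_intros)
    moreover have "\<forall>\<^sub>F t in at_right 0. a - b - s \<le> t * M"
      using eventually_at_right_field[of _ "0::real"] key by (auto intro!: exI[of _ 1])
    ultimately have "a - b - s \<le> 0"
      using tendsto_lowerbound[of "\<lambda>t. t * M" "0 * M" "at_right (0::real)" "a - b - s"] by simp
    then show ?thesis by (simp add: s_def d_def)
  qed
  with a show thesis by (rule that)
qed

section \<open>ADMM as a Douglas--Rachford iteration on the dual\<close>

text \<open>
  With \<open>n\<close> a difference of multipliers and \<open>v\<close> the corresponding difference of the vectors \<open>B y\<close>,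
  this compares multipliers with the points of the orbit.
\<close>
lemma power2_norm_le_shift:
  fixes n v :: "'a::real_inner"
  shows "(norm n)\<^sup>2 \<le> (norm (n - \<alpha> *\<^sub>R v))\<^sup>2 + 2 * (\<alpha> * (n \<bullet> v))"
proof -
  have "(norm (n - \<alpha> *\<^sub>R v))\<^sup>2 = (norm n)\<^sup>2 - 2 * (\<alpha> * (n \<bullet> v)) + (norm (\<alpha> *\<^sub>R v))\<^sup>2"
    unfolding power2_norm_eq_inner by (simp add: algebra_simps inner_commute)
  then show ?thesis using zero_le_power2[of "norm (\<alpha> *\<^sub>R v)"] by linarith
qed

text \<open>
  The linear and the quadratic term together have as gradient the updated multiplier, pulled back
  by the transpose; its negative is therefore a subgradient.
\<close>
lemma argmin_subgradient:
  fixes h :: "real^'p \<Rightarrow> ereal" and K :: "real^'p^'n"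
  assumes "\<And>u. h u \<noteq> -\<infinity>" and "proper_fun h" and "convex_fun h" and "\<gamma> > 0"
    and "is_arg_min (\<lambda>u. h u + ereal (\<nu> \<bullet> (K *v u + d) + 1 / (2 * \<gamma>) * (norm (K *v u + d))\<^sup>2))
           (\<lambda>u. True) x"
  shows "subgradient_at h (- (transpose K *v (\<nu> + (1 / \<gamma>) *\<^sub>R (K *v x + d)))) x"
proof -
  have aff: "K *v (t *\<^sub>R u + (1 - t) *\<^sub>R x) + d = K *v x + d + t *\<^sub>R (K *v u + d - (K *v x + d))" for u t
    by (simp add: matrix_vector_right_distrib matrix_vector_mult_scaleR algebra_simps)
  obtain a where "h x = ereal a"
    and le: "\<And>u b. h u = ereal b \<Longrightarrow>
      a \<le> b + (\<nu> + (1 / \<gamma>) *\<^sub>R (K *v x + d)) \<bullet> (K *v u + d - (K *v x + d))"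
    using argmin_optimality[OF assms(1-4), where R = "\<lambda>u. K *v u + d" and x = x and \<nu> = \<nu>] aff assms(5) by blast
  moreover have "a + - (transpose K *v (\<nu> + (1 / \<gamma>) *\<^sub>R (K *v x + d))) \<bullet> (u - x) \<le> b"
    if "h u = ereal b" for u b
    using le[OF that] by (simp add: dot_lmul_matrix matrix_vector_mult_diff_distrib)
  ultimately show ?thesis unfolding subgradient_at_def by blast
qed

lemma dual_feasible_point:
  fixes A :: "real^'p^'n"
  assumes "proper_fun f" "proper_fun g" "dual_value f g A B c \<noteq> -\<infinity>"
  obtains \<nu> s t where "convex_conjugate f (- (transpose A *v \<nu>)) = ereal s"
    and "convex_conjugate g (- (transpose B *v \<nu>)) = ereal t"
proof -
  let ?F = "\<lambda>\<nu>. convex_conjugate f (- (transpose A *v \<nu>))"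
  let ?G = "\<lambda>\<nu>. convex_conjugate g (- (transpose B *v \<nu>))"
  have "\<exists>\<nu>. - ?F \<nu> - ?G \<nu> - ereal (c \<bullet> \<nu>) \<noteq> -\<infinity>"
  proof (rule ccontr)
    assume "\<nexists>\<nu>. - ?F \<nu> - ?G \<nu> - ereal (c \<bullet> \<nu>) \<noteq> -\<infinity>"
    then have "dual_value f g A B c = (SUP \<nu>::real^'n. -\<infinity>)"
      unfolding dual_value_def by (intro SUP_cong) blast+
    then show False using assms(3) by simp
  qed
  then obtain \<nu> where \<nu>: "- ?F \<nu> - ?G \<nu> - ereal (c \<bullet> \<nu>) \<noteq> -\<infinity>" by blast
  show thesis
  proof (rule that)
    show "?F \<nu> = ereal (real_of_ereal (?F \<nu>))" "?G \<nu> = ereal (real_of_ereal (?G \<nu>))"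
      using \<nu> convex_conjugate_not_MInfty[OF assms(1), of "- (transpose A *v \<nu>)"]
        convex_conjugate_not_MInfty[OF assms(2), of "- (transpose B *v \<nu>)"]
      by (cases "?F \<nu>"; cases "?G \<nu>"; simp)+
  qed
qed

text \<open>
  Here \<open>P\<close> and \<open>Q\<close> are differences of two dual resolvent values, \<open>a\<close> and \<open>b\<close> the scaled differences of
  the subgradients belonging to them (up to sign). Two monotonicity inequalities add up to firm
  nonexpansiveness of the map sending \<open>z k\<close> to \<open>z (k+1)\<close>, whose differences are \<open>Q - b\<close> and
  \<open>P - b\<close>.
\<close>
lemma douglas_rachford_firm:
  fixes P Q a b :: "'a::real_inner"
  assumes "a = P - Q - b" "P \<bullet> a \<le> 0" "Q \<bullet> b \<le> 0"
  shows "(P - b) \<bullet> ((P - b) - (Q - b)) \<le> 0"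
proof -
  have Q: "Q = P - a - b" using assms(1) by simp
  show ?thesis
    using assms(2,3) unfolding Q by (simp add: algebra_simps inner_commute)
qed

theorem theorem14:
  fixes f :: "real^'p \<Rightarrow> ereal" and g :: "real^'q \<Rightarrow> ereal"
    and A :: "real^'p^'n" and B :: "real^'q^'n" and c :: "real^'n" and \<gamma> :: real
    and x :: "nat \<Rightarrow> real^'p" and y :: "nat \<Rightarrow> real^'q" and \<nu> :: "nat \<Rightarrow> real^'n"
  assumes "\<And>u. f u \<noteq> -\<infinity>" and "closed_fun f" and "proper_fun f" and "convex_fun f"
    and "\<And>w. g w \<noteq> -\<infinity>" and "closed_fun g" and "proper_fun g" and "convex_fun g"
    and "\<gamma> > 0"
    and "range (\<lambda>\<mu>. transpose A *v \<mu>) \<inter> rel_interior (eff_dom (convex_conjugate f)) \<noteq> {}"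
    and "range (\<lambda>\<mu>. transpose B *v \<mu>) \<inter> rel_interior (eff_dom (convex_conjugate g)) \<noteq> {}"
    and "admm_sequence f g A B c \<gamma> x y \<nu>"
    and "dual_value f g A B c = \<infinity>" and "primal_value f g A B c = \<infinity>"
    and "\<not> primal_feasible f g A B c"
  shows "(\<lambda>k. norm (A *v x k + B *v y k - c))
           \<longlonglongrightarrow> (INF (u, w) \<in> eff_dom f \<times> eff_dom g. norm (A *v u + B *v w - c))"
proof -
  define \<alpha> where "\<alpha> = 1 / \<gamma>"
  have \<alpha>: "\<alpha> > 0" using \<open>\<gamma> > 0\<close> by (simp add: \<alpha>_def)
  \<comment> \<open>The intermediate multiplier after the update of \<open>x\<close> only: the optimality condition of the
    \<open>x\<close>-step holds at \<open>\<eta> k\<close>, that of the \<open>y\<close>-step at \<open>\<nu> (Suc k)\<close>.\<close>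
  define \<eta> where "\<eta> k = \<nu> k + \<alpha> *\<^sub>R (A *v x (Suc k) + B *v y k - c)" for k
  define z where "z k = \<nu> k - \<alpha> *\<^sub>R (B *v y k)" for k
  note admm = \<open>admm_sequence f g A B c \<gamma> x y \<nu>\<close>[unfolded admm_sequence_def]
  have \<nu>_Suc: "\<nu> (Suc k) = \<nu> k + \<alpha> *\<^sub>R (A *v x (Suc k) + B *v y (Suc k) - c)" for k
    using admm by (simp add: \<alpha>_def)
  have sub_f: "subgradient_at f (- (transpose A *v \<eta> k)) (x (Suc k))" for k
  proof -
    have e: "A *v u + B *v y k - c = A *v u + (B *v y k - c)" for u by simp
    show ?thesis
      unfolding \<eta>_def \<alpha>_def e
      by (rule argmin_subgradient[OF assms(1,3,4,9)])
        (rule admm[rule_format, THEN conjunct1, of k, unfolded e])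
  qed
  have sub_g: "subgradient_at g (- (transpose B *v \<nu> (Suc k))) (y (Suc k))" for k
  proof -
    have e: "A *v x (Suc k) + B *v w - c = B *v w + (A *v x (Suc k) - c)" for w by simp
    show ?thesis
      unfolding \<nu>_Suc \<alpha>_def e
      by (rule argmin_subgradient[OF assms(5,7,8,9)])
        (rule admm[rule_format, THEN conjunct2, THEN conjunct1, of k, unfolded e])
  qed
  have mono_f: "(\<eta> j - \<eta> k) \<bullet> (A *v x (Suc j) - A *v x (Suc k)) \<le> 0" for j k
    using subgradient_at_monotone[OF sub_f sub_f, of j k]
    by (simp add: inner_diff_left dot_lmul_matrix matrix_vector_mult_diff_distrib)
  have mono_g: "(\<nu> (Suc j) - \<nu> (Suc k)) \<bullet> (B *v y (Suc j) - B *v y (Suc k)) \<le> 0" for j k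
    using subgradient_at_monotone[OF sub_g sub_g, of j k]
    by (simp add: inner_diff_left dot_lmul_matrix matrix_vector_mult_diff_distrib)
  have z_Suc: "z (Suc k) = \<eta> k - \<alpha> *\<^sub>R (B *v y k)" for k
    by (simp add: z_def \<eta>_def \<nu>_Suc algebra_simps)
  have z_step: "z (Suc k) - z k = \<eta> k - \<nu> k" for k
    unfolding z_Suc by (simp add: z_def)

  \<comment> \<open>The orbit is started at index 1, because \<open>y 0\<close> is arbitrary and satisfies no optimality condition.\<close>
  have "\<exists>L. (\<lambda>k. norm (z (Suc (Suc k)) - z (Suc k))) \<longlonglongrightarrow> L \<and>
      (\<forall>m. real m * L \<le> norm (z (Suc m) - z (Suc 0)))"
  proof -
    have "(z (Suc (Suc j)) - z (Suc (Suc k)))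
        \<bullet> ((z (Suc (Suc j)) - z (Suc (Suc k))) - (z (Suc j) - z (Suc k))) \<le> 0" for j k
    proof -
      define P Q a b where "P = \<eta> (Suc j) - \<eta> (Suc k)" and "Q = \<nu> (Suc j) - \<nu> (Suc k)"
        and "a = \<alpha> *\<^sub>R (A *v x (Suc (Suc j)) - A *v x (Suc (Suc k)))"
        and "b = \<alpha> *\<^sub>R (B *v y (Suc j) - B *v y (Suc k))"
      have "a = P - Q - b" by (simp add: P_def Q_def a_def b_def \<eta>_def algebra_simps)
      moreover have "P \<bullet> a \<le> 0"
        using mono_f[of "Suc j" "Suc k"] \<alpha> by (simp add: P_def a_def mult_le_0_iff)
      moreover have "Q \<bullet> b \<le> 0"
        using mono_g[of j k] \<alpha> by (simp add: Q_def b_def mult_le_0_iff)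
      ultimately have "(P - b) \<bullet> ((P - b) - (Q - b)) \<le> 0" by (rule douglas_rachford_firm)
      moreover have "z (Suc (Suc j)) - z (Suc (Suc k)) = P - b"
        by (simp add: z_Suc P_def b_def algebra_simps)
      moreover have "z (Suc j) - z (Suc k) = Q - b"
        by (simp add: z_def Q_def b_def algebra_simps)
      ultimately show ?thesis by simp
    qed
    then show ?thesis
      using firm_orbit_escape_rate[of "\<lambda>k. z (Suc k)"] by metis
  qed
  then obtain L where L: "(\<lambda>k. norm (z (Suc (Suc k)) - z (Suc k))) \<longlonglongrightarrow> L"
    and escape: "\<And>m. real m * L \<le> norm (z (Suc m) - z (Suc 0))" by blast

  obtain \<nu>' s t where s: "convex_conjugate f (- (transpose A *v \<nu>')) = ereal s"
    and t: "convex_conjugate g (- (transpose B *v \<nu>')) = ereal t"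
    using dual_feasible_point[OF assms(3,7), of A B c] assms(13) by auto

  have L_le: "L / \<alpha> \<le> norm (A *v u + B *v w - c)" if u: "u \<in> eff_dom f" and w: "w \<in> eff_dom g" for u w
  proof -
    obtain b where b: "f u = ereal b" using u assms(1)[of u] by (cases "f u") (auto simp: eff_dom_def)
    obtain e where e: "g w = ereal e" using w assms(5)[of w] by (cases "g w") (auto simp: eff_dom_def)
    define r where "r = A *v u + B *v w - c"
    define Cf Cg where "Cf = b + s + \<nu>' \<bullet> (A *v u)" and "Cg = e + t + \<nu>' \<bullet> (B *v w)"
    define \<zeta> where "\<zeta> = \<nu>' - \<alpha> *\<^sub>R (B *v w)"
    \<comment> \<open>The \<open>x\<close>-iterate is paired below with the previous \<open>y\<close>-iterate, since
      \<open>z (k+1) - z k\<close> is the multiple by \<open>\<alpha>\<close> of the residual of that pair.\<close>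
    have gap_f: "(\<eta> k - \<nu>') \<bullet> (A *v x (Suc k) - A *v u) \<le> Cf" for k
      using subgradient_at_conjugate_bound[OF sub_f s b, of k]
      by (simp add: Cf_def inner_diff_left inner_diff_right dot_lmul_matrix matrix_vector_mult_diff_distrib)
    have gap_g: "(\<nu> (Suc k) - \<nu>') \<bullet> (B *v y (Suc k) - B *v w) \<le> Cg" for k
      using subgradient_at_conjugate_bound[OF sub_g t e, of k]
      by (simp add: Cg_def inner_diff_left inner_diff_right dot_lmul_matrix matrix_vector_mult_diff_distrib)
    have \<nu>_le: "norm (\<nu> (Suc k) - \<nu>') \<le> norm (z (Suc k) - \<zeta>) + sqrt (2 * \<alpha> * \<bar>Cg\<bar>)" for k
    proof -
      define n v where "n = \<nu> (Suc k) - \<nu>'" and "v = B *v y (Suc k) - B *v w"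
      have zn: "z (Suc k) - \<zeta> = n - \<alpha> *\<^sub>R v"
        by (simp add: z_def \<zeta>_def n_def v_def algebra_simps)
      have "n \<bullet> v \<le> \<bar>Cg\<bar>" using gap_g[of k] by (simp add: n_def v_def)
      then have nv: "\<alpha> * (n \<bullet> v) \<le> \<alpha> * \<bar>Cg\<bar>" using \<alpha> by simp
      then have "(norm n)\<^sup>2 \<le> (norm (n - \<alpha> *\<^sub>R v))\<^sup>2 + 2 * \<alpha> * \<bar>Cg\<bar>"
        using power2_norm_le_shift[of n \<alpha> v] by linarith
      then have "norm n \<le> sqrt ((norm (n - \<alpha> *\<^sub>R v))\<^sup>2 + 2 * \<alpha> * \<bar>Cg\<bar>)" by (rule real_le_rsqrt)
      also have "\<dots> \<le> sqrt ((norm (n - \<alpha> *\<^sub>R v))\<^sup>2) + sqrt (2 * \<alpha> * \<bar>Cg\<bar>)"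
        using \<alpha> by (intro sqrt_add_le_add_sqrt) auto
      finally show ?thesis unfolding zn by (simp add: n_def)
    qed
    \<comment> \<open>The step lengths are bounded, so passing from index \<open>k\<close> to \<open>k+1\<close> costs a constant only.\<close>
    obtain S where S: "\<And>k. norm (z (Suc (Suc k)) - z (Suc k)) \<le> S"
      using convergent_imp_Bseq[OF convergentI[OF L]] unfolding Bseq_def by auto
    have S0: "0 \<le> S" using S[of 0] norm_ge_zero order_trans by blast
    define D C where "D = 2 * S + sqrt (2 * \<alpha> * \<bar>Cg\<bar>)" and "C = \<alpha> * \<bar>Cf + Cg\<bar> + \<alpha> * norm r * D"
    have "L \<le> \<alpha> * norm r"
    proof (rule escape_rate_le[of L "\<lambda>k. z (Suc k)" \<zeta> C])
      fix k
      define p n v \<delta> where "p = \<eta> (Suc k) - \<nu>'" and "n = \<nu> (Suc k) - \<nu>'"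
        and "v = B *v y (Suc k) - B *v w" and "\<delta> = z (Suc (Suc k)) - z (Suc k)"
      have pn: "p = n + \<delta>" by (simp add: p_def n_def \<delta>_def z_step)
      have zp: "z (Suc (Suc k)) - \<zeta> = p - \<alpha> *\<^sub>R v"
        by (simp add: z_Suc \<zeta>_def p_def v_def algebra_simps)
      have Ax: "\<alpha> *\<^sub>R (A *v x (Suc (Suc k)) - A *v u) = \<delta> - \<alpha> *\<^sub>R r - \<alpha> *\<^sub>R v"
        by (simp add: \<delta>_def z_step \<eta>_def r_def v_def algebra_simps)
      \<comment> \<open>The two gap inequalities, rewritten in terms of the orbit: \<open>r\<close> is the only term
        that is not absorbed into \<open>\<delta>\<close> and \<open>v\<close>.\<close>
      have "p \<bullet> (A *v x (Suc (Suc k)) - A *v u) + n \<bullet> v \<le> Cf + Cg"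
        using gap_f[of "Suc k"] gap_g[of k] by (simp add: p_def n_def v_def)
      then have "\<alpha> * (p \<bullet> (A *v x (Suc (Suc k)) - A *v u) + n \<bullet> v) \<le> \<alpha> * \<bar>Cf + Cg\<bar>"
        using \<alpha> by (intro mult_left_mono) auto
      then have "p \<bullet> (\<delta> - \<alpha> *\<^sub>R r - \<alpha> *\<^sub>R v) + \<alpha> * (n \<bullet> v) \<le> \<alpha> * \<bar>Cf + Cg\<bar>"
        unfolding Ax[symmetric] by (simp add: distrib_left)
      moreover have "(p - \<alpha> *\<^sub>R v) \<bullet> \<delta> = p \<bullet> (\<delta> - \<alpha> *\<^sub>R r - \<alpha> *\<^sub>R v) + \<alpha> * (n \<bullet> v) + \<alpha> * (p \<bullet> r)"
        by (simp add: pn algebra_simps inner_commute)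
      moreover have "\<alpha> * (p \<bullet> r) \<le> \<alpha> * norm r * norm p"
        using norm_cauchy_schwarz[of p r] \<alpha> by (simp add: mult.commute mult.left_commute)
      moreover have "\<alpha> * norm r * norm p \<le> \<alpha> * norm r * (norm (p - \<alpha> *\<^sub>R v) + D)"
      proof (rule mult_left_mono)
        have "norm p \<le> norm n + S"
          using norm_triangle_ineq[of n \<delta>] S[of k] by (simp add: pn \<delta>_def)
        moreover have "norm (z (Suc k) - \<zeta>) \<le> norm (p - \<alpha> *\<^sub>R v) + S"
          using norm_triangle_ineq4[of "z (Suc (Suc k)) - \<zeta>" \<delta>] S[of k] unfolding zp[symmetric]
          by (simp add: \<delta>_def)
        ultimately show "norm p \<le> norm (p - \<alpha> *\<^sub>R v) + D"
          using \<nu>_le[of k] by (simp add: D_def n_def)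
      qed (use \<alpha> in simp)
      ultimately show "(z (Suc (Suc k)) - \<zeta>) \<bullet> (z (Suc (Suc k)) - z (Suc k))
          \<le> C + \<alpha> * norm r * norm (z (Suc (Suc k)) - \<zeta>)"
        unfolding zp \<delta>_def[symmetric] C_def by (simp add: algebra_simps)
    qed (use escape \<alpha> S0 in \<open>auto simp: C_def D_def\<close>)
    then show ?thesis using \<alpha> by (simp add: r_def field_simps)
  qed

  define I where "I = (INF (u, w) \<in> eff_dom f \<times> eff_dom g. norm (A *v u + B *v w - c))"
  have I_le: "I \<le> norm (A *v u + B *v w - c)" if "u \<in> eff_dom f" "w \<in> eff_dom g" for u w
  proof -
    have "bdd_below ((\<lambda>(u, w). norm (A *v u + B *v w - c)) ` (eff_dom f \<times> eff_dom g))"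
      by (intro bdd_belowI[of _ 0]) auto
    then show ?thesis unfolding I_def using cINF_lower[of "\<lambda>(u, w). norm (A *v u + B *v w - c)" _ "(u, w)"] that by auto
  qed
  have dom: "x (Suc k) \<in> eff_dom f" "y (Suc k) \<in> eff_dom g" for k
    using sub_f[of k] sub_g[of k] by (auto simp: subgradient_at_def eff_dom_def)
  have "L / \<alpha> \<le> I"
    unfolding I_def using dom L_le by (intro cINF_greatest) auto
  have lower: "I \<le> norm (A *v x (Suc (Suc k)) + B *v y (Suc (Suc k)) - c)" for k
    by (rule I_le) (rule dom)+
  have upper: "norm (A *v x (Suc (Suc k)) + B *v y (Suc (Suc k)) - c)
      \<le> norm (z (Suc (Suc k)) - z (Suc k)) / \<alpha>" for k
  proof -
    define n v where "n = \<nu> (Suc (Suc k)) - \<nu> (Suc k)" and "v = B *v y (Suc (Suc k)) - B *v y (Suc k)"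
    have "\<alpha> * (n \<bullet> v) \<le> 0" using mono_g[of "Suc k" k] \<alpha> by (simp add: n_def v_def mult_le_0_iff)
    then have "(norm n)\<^sup>2 \<le> (norm (n - \<alpha> *\<^sub>R v))\<^sup>2"
      using power2_norm_le_shift[of n \<alpha> v] by linarith
    then have "norm n \<le> norm (n - \<alpha> *\<^sub>R v)" by (rule power2_le_imp_le) simp
    moreover have "n - \<alpha> *\<^sub>R v = z (Suc (Suc k)) - z (Suc k)"
      by (simp add: n_def v_def z_def algebra_simps)
    moreover have "norm n = \<alpha> * norm (A *v x (Suc (Suc k)) + B *v y (Suc (Suc k)) - c)"
      using \<alpha> by (simp add: n_def \<nu>_Suc[of "Suc k"])
    ultimately show ?thesis using \<alpha> by (simp add: field_simps)
  qed
  have lim: "(\<lambda>k. norm (z (Suc (Suc k)) - z (Suc k)) / \<alpha>) \<longlonglongrightarrow> L / \<alpha>"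
    by (intro tendsto_divide L tendsto_const) (use \<alpha> in simp)
  have "I \<le> L / \<alpha>"
    using lower upper order_trans by (intro LIMSEQ_le_const[OF lim]) blast
  with \<open>L / \<alpha> \<le> I\<close> have "L / \<alpha> = I" by simp
  then have "(\<lambda>k. norm (A *v x (Suc (Suc k)) + B *v y (Suc (Suc k)) - c)) \<longlonglongrightarrow> I"
    using lower upper lim by (intro tendsto_sandwich[OF _ _ tendsto_const lim[unfolded \<open>L / \<alpha> = I\<close>]]) auto
  then show ?thesis
    unfolding I_def[symmetric] by (rule LIMSEQ_imp_Suc[OF LIMSEQ_imp_Suc])
qed

end
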